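(* Let $M$ be an arbitrary Orlicz function, let $\lambda=\{\lambda_k\}_{k=1}^\infty$ be an arbitrary sequence of positive numbers with $\lim_{k\to\infty}\lambda_k=0$, and let $T$ be the diagonal operator $T\{x_k\}_{k=1}^\infty=\{\lambda_kx_k\}_{k=1}^\infty$. Then for every $n\in\mathbb N$, $$d_{\delta_{n-1}}(T:l_M\to l_M)=d_{\delta_{n-1}+1}(T:l_M\to l_M)=\dots=d_{\delta_n-1}(T:l_M\to l_M)=E_{g_{n-1}^\lambda}(T:l_M\to l_M)=\varepsilon_n,$$ where $\delta_s$, $\varepsilon_s$ and $g_s^\lambda$ are the elements of the characteristic sequences $\delta(\lambda)$, $\varepsilon(\lambda)$ and $g(\lambda)$ of $\lambda$, with $\delta_0=0$ and $g_0^\lambda=\emptyset$.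
   Context: An Orlicz function is a non-decreasing convex function $M:[0,\infty)\to[0,\infty)$ with $M(0)=0$ and $M(t)\to\infty$ as $t\to\infty$. The Orlicz sequence space $l_M$ is the Banach space of all real sequences $x=\{x_k\}_{k=1}^\infty$ with finite norm $$\|x\|_{l_M}:=\inf\Big\{\alpha>0:\ \sum_{k=1}^\infty M(|x_k|/\alpha)\le 1\Big\}.$$ $B\,l_M=\{x\in l_M:\|x\|_{l_M}\le 1\}$ is its closed unit ball. $e_i$ denotes the sequence whose $i$-th entry is $1$ and whose other entries are $0$. Characteristic sequences: $\varepsilon(\lambda)=\varepsilon_1,\varepsilon_2,\dots$ is the sequence of distinct values of the $\lambda_k$ listed in decreasing order; $g(\lambda)$ is the sequence of finite sets $g_n^\lambda=\{k\in\mathbb N:\lambda_k\ge\varepsilon_n\}$, $n\ge1$; $\delta(\lambda)$ is the sequence of cardinalities $\delta_n=|g_n^\lambda|$. By convention $g_0^\lambda=\emptyset$ and $\delta_0=0$. For a finite set $\gamma\subset\mathbb N$, $$E_{\gamma}(T:l_M\to l_M):=\sup_{x\in B\,l_M}\ \inf_{a_i\in\mathbb R,\ i\in\gamma}\Big\|Tx-\sum_{i\in\gamma}a_ie_i\Big\|_{l_M}$$ (for $\gamma=\emptyset$ the sum is the zero element). The Kolmogorov width of order $\nu\ge 0$ is $$d_\nu(T:l_M\to l_M):=\inf_{F_\nu}\ \sup_{x\in B\,l_M}\ \inf_{u\in F_\nu}\|Tx-u\|_{l_M},$$ where the outer infimum is over all linear subspaces $F_\nu$ of $l_M$ of dimension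 $\nu$ (for $\nu=0$, only the zero subspace). *)

theory Defs
  imports "HOL-Analysis.Analysis" "HOL-Library.Function_Algebras"
begin

text \<open>
  Sequences are functions of type nat => real: the coordinates are numbered from 0, whereas the
  characteristic sequences below are numbered from 1. The pointwise vector space structure makes
  the library notions span and independent available for sequences.
\<close>

instantiation "fun" :: (type, real_vector) real_vector
begin

definition scaleR_fun :: "real \<Rightarrow> ('a \<Rightarrow> 'b) \<Rightarrow> 'a \<Rightarrow> 'b" where
  "scaleR_fun c f = (\<lambda>x. c *\<^sub>R f x)"

instance
  by standard (simp_all add: scaleR_fun_def plus_fun_def fun_eq_iff algebra_simps)

end

definition orlicz :: "(real \<Rightarrow> real) \<Rightarrow> bool" where
  "orlicz M \<longleftrightarrow>
     (\<forall>t\<ge>0. 0 \<le> M t) \<and> mono_on {0..} M \<and> convex_on {0..} M \<and> M 0 = 0 \<and>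
     filterlim M at_top at_top"

text \<open>
  The norm takes values in the extended nonnegative reals: a divergent series has value \<open>\<infinity>\<close>, and
  the infimum of the empty set is \<open>\<infinity>\<close>. All suprema and infima below are therefore those of a
  complete lattice.
\<close>

definition orlicz_norm :: "(real \<Rightarrow> real) \<Rightarrow> (nat \<Rightarrow> real) \<Rightarrow> ennreal" where
  "orlicz_norm M x = Inf {ennreal \<alpha> | \<alpha>. 0 < \<alpha> \<and> (\<Sum>k. ennreal (M (\<bar>x k\<bar> / \<alpha>))) \<le> 1}"

definition orlicz_space :: "(real \<Rightarrow> real) \<Rightarrow> (nat \<Rightarrow> real) set" where
  "orlicz_space M = {x. orlicz_norm M x < \<infinity>}"

definition orlicz_ball :: "(real \<Rightarrow> real) \<Rightarrow> (nat \<Rightarrow> real) set" where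
  "orlicz_ball M = {x \<in> orlicz_space M. orlicz_norm M x \<le> 1}"

definition unit_seq :: "nat \<Rightarrow> nat \<Rightarrow> real" where
  "unit_seq i = (\<lambda>k. if k = i then 1 else 0)"

definition diag_op :: "(nat \<Rightarrow> real) \<Rightarrow> (nat \<Rightarrow> real) \<Rightarrow> nat \<Rightarrow> real" where
  "diag_op lam x = (\<lambda>k. lam k * x k)"

definition coord_approx ::
    "(real \<Rightarrow> real) \<Rightarrow> nat set \<Rightarrow> ((nat \<Rightarrow> real) \<Rightarrow> nat \<Rightarrow> real) \<Rightarrow> ennreal" where
  "coord_approx M \<gamma> T =
     (SUP x \<in> orlicz_ball M. INF a :: nat \<Rightarrow> real.
        orlicz_norm M (T x - (\<Sum>i\<in>\<gamma>. a i *\<^sub>R unit_seq i)))"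

text \<open>
  The dimension is expressed through a finite basis, since the library function dim also has the
  value 0 on infinite-dimensional subspaces.
\<close>

definition subspaces_of_dim :: "(real \<Rightarrow> real) \<Rightarrow> nat \<Rightarrow> (nat \<Rightarrow> real) set set" where
  "subspaces_of_dim M \<nu> =
     {F. F \<subseteq> orlicz_space M \<and> (\<exists>B. finite B \<and> card B = \<nu> \<and> independent B \<and> span B = F)}"

definition kolmogorov_width ::
    "(real \<Rightarrow> real) \<Rightarrow> nat \<Rightarrow> ((nat \<Rightarrow> real) \<Rightarrow> nat \<Rightarrow> real) \<Rightarrow> ennreal" where
  "kolmogorov_width M \<nu> T =
     (INF F \<in> subspaces_of_dim M \<nu>. SUP x \<in> orlicz_ball M. INF u \<in> F. orlicz_norm M (T x - u))"

text \<open>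
  The characteristic sequences carry their information at the indices \<open>n \<ge> 1\<close>. The value of
  \<open>char_eps\<close> at 0 is a dummy, while \<open>char_g\<close> and \<open>char_delta\<close> at 0 follow the usual convention.
\<close>

fun char_eps :: "(nat \<Rightarrow> real) \<Rightarrow> nat \<Rightarrow> real" where
  "char_eps lam 0 = 0"
| "char_eps lam (Suc 0) = (GREATEST v. v \<in> range lam)"
| "char_eps lam (Suc (Suc n)) = (GREATEST v. v \<in> range lam \<and> v < char_eps lam (Suc n))"

definition char_g :: "(nat \<Rightarrow> real) \<Rightarrow> nat \<Rightarrow> nat set" where
  "char_g lam n = (if n = 0 then {} else {k. char_eps lam n \<le> lam k})"

definition char_delta :: "(nat \<Rightarrow> real) \<Rightarrow> nat \<Rightarrow> nat" where
  "char_delta lam n = card (char_g lam n)"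

text \<open>
  For positive sequences tending to 0 the maxima in \<open>char_eps\<close> exist, so that \<open>char_eps\<close> lists
  the distinct values of the sequence in strictly decreasing order, and the sets \<open>char_g\<close> are
  finite.
\<close>

lemma finite_superlevel:
  fixes lam :: "nat \<Rightarrow> real"
  assumes "lam \<longlonglongrightarrow> 0" "0 < c"
  shows "finite {k. c \<le> lam k}"
proof -
  have "eventually (\<lambda>k. lam k < c) sequentially"
    using order_tendstoD(2)[OF assms] .
  then have "eventually (\<lambda>k. \<not> c \<le> lam k) sequentially"
    by (rule eventually_mono) simp
  then show ?thesis
    by (simp add: eventually_cofinite flip: cofinite_eq_sequentially)
qed

lemma Greatest_value:
  fixes lam :: "nat \<Rightarrow> real"
  assumes pos: "\<And>k. 0 < lam k" and lim: "lam \<longlonglongrightarrow> 0" and ex: "\<exists>v. v \<in> range lam \<and> P v"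
  defines "m \<equiv> GREATEST v. v \<in> range lam \<and> P v"
  shows "m \<in> range lam" "P m" "\<And>v. v \<in> range lam \<Longrightarrow> P v \<Longrightarrow> v \<le> m"
proof -
  obtain j where j: "P (lam j)" using ex by auto
  define S where "S = {v \<in> range lam. P v \<and> lam j \<le> v}"
  have fin: "finite S"
    by (rule finite_subset[OF _ finite_imageI[OF finite_superlevel[OF lim pos[of j]], of lam]])
      (auto simp: S_def)
  have jS: "lam j \<in> S" using j by (simp add: S_def)
  have "Max S \<in> S" using fin jS Max_in by blast
  moreover have le: "v \<le> Max S" if "v \<in> range lam" "P v" for v
  proof (cases "lam j \<le> v")
    case True
    then show ?thesis using that fin by (auto simp: S_def intro!: Max_ge)
  next
    case False
    then show ?thesis using Max_ge[OF fin jS] by linarith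
  qed
  ultimately have "m = Max S"
    unfolding m_def by (intro Greatest_equality) (auto simp: S_def)
  then show "m \<in> range lam" "P m" "\<And>v. v \<in> range lam \<Longrightarrow> P v \<Longrightarrow> v \<le> m"
    using \<open>Max S \<in> S\<close> le by (auto simp: S_def)
qed

lemma ex_smaller_value:
  fixes lam :: "nat \<Rightarrow> real"
  assumes "\<And>k. 0 < lam k" "lam \<longlonglongrightarrow> 0" "v \<in> range lam"
  shows "\<exists>w. w \<in> range lam \<and> w < v"
proof -
  have "0 < v" using assms by auto
  then have "eventually (\<lambda>k. lam k < v) sequentially"
    using order_tendstoD(2)[OF assms(2)] by blast
  then show ?thesis by (auto simp: eventually_sequentially)
qed

lemma char_eps_in_range:
  assumes "\<And>k. 0 < lam k" "lam \<longlonglongrightarrow> 0"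
  shows "char_eps lam (Suc n) \<in> range lam"
proof (induction n)
  case 0
  show ?case using Greatest_value(1)[OF assms, of "\<lambda>_. True"] by auto
next
  case (Suc n)
  show ?case using Greatest_value(1)[OF assms ex_smaller_value[OF assms Suc.IH]] by simp
qed

lemma char_eps_Suc_less:
  assumes "\<And>k. 0 < lam k" "lam \<longlonglongrightarrow> 0"
  shows "char_eps lam (Suc (Suc n)) < char_eps lam (Suc n)"
  using Greatest_value(2)[OF assms ex_smaller_value[OF assms char_eps_in_range[OF assms]], of n]
  by simp

lemma char_eps_less:
  assumes "\<And>k. 0 < lam k" "lam \<longlonglongrightarrow> 0" "1 \<le> m" "m < n"
  shows "char_eps lam n < char_eps lam m"
proof -
  have "strict_mono (\<lambda>n. - char_eps lam (Suc n))"
    using char_eps_Suc_less[OF assms(1,2)] by (auto simp: strict_mono_Suc_iff)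
  from strict_monoD[OF this, of "m - 1" "n - 1"] show ?thesis using assms(3,4) by auto
qed

lemma finite_char_g:
  assumes "\<And>k. 0 < lam k" "lam \<longlonglongrightarrow> 0"
  shows "finite (char_g lam n)"
proof (cases n)
  case (Suc m)
  then have "0 < char_eps lam n" using char_eps_in_range[OF assms, of m] assms(1) by auto
  then show ?thesis using finite_superlevel[OF assms(2)] Suc by (simp add: char_g_def)
qed (simp add: char_g_def)

lemma char_eps_image:
  assumes "\<And>k. 0 < lam k" "lam \<longlonglongrightarrow> 0"
  shows "char_eps lam ` {1..} = range lam"
proof
  show "char_eps lam ` {1..} \<subseteq> range lam"
  proof (rule image_subsetI)
    fix n :: nat assume "n \<in> {1..}"
    then show "char_eps lam n \<in> range lam" using char_eps_in_range[OF assms, of "n - 1"] by simp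
  qed
  show "range lam \<subseteq> char_eps lam ` {1..}"
  proof (rule ccontr)
    assume "\<not> ?thesis"
    then obtain v where v: "v \<in> range lam" "v \<notin> char_eps lam ` {1..}" by auto
    have less: "v < char_eps lam (Suc n)" for n
    proof (induction n)
      case 0
      have "v \<le> char_eps lam (Suc 0)"
        using Greatest_value(3)[OF assms, of "\<lambda>_. True" v] v(1) by auto
      moreover have "v \<noteq> char_eps lam (Suc 0)"
        using v(2) imageI[of "Suc 0" "{1..}" "char_eps lam"] by auto
      ultimately show ?case by linarith
    next
      case (Suc n)
      have "v \<le> char_eps lam (Suc (Suc n))"
        using Greatest_value(3)[OF assms ex_smaller_value[OF assms char_eps_in_range[OF assms]],
            of v n] v(1) Suc.IH by simp
      moreover have "v \<noteq> char_eps lam (Suc (Suc n))"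
        using v(2) imageI[of "Suc (Suc n)" "{1..}" "char_eps lam"] by auto
      ultimately show ?case by linarith
    qed
    have "inj (\<lambda>n. char_eps lam (Suc n))"
    proof (rule linorder_injI)
      fix x y :: nat assume "x < y"
      then have "char_eps lam (Suc y) < char_eps lam (Suc x)"
        by (intro char_eps_less[OF assms]) auto
      then show "char_eps lam (Suc x) \<noteq> char_eps lam (Suc y)" by simp
    qed
    then have "infinite (range (\<lambda>n. char_eps lam (Suc n)))" by (rule range_inj_infinite)
    moreover have "range (\<lambda>n. char_eps lam (Suc n)) \<subseteq> lam ` {k. v \<le> lam k}"
    proof (rule image_subsetI)
      fix n
      show "char_eps lam (Suc n) \<in> lam ` {k. v \<le> lam k}"
        using char_eps_in_range[OF assms, of n] less[of n] by auto
    qed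
    moreover have "finite (lam ` {k. v \<le> lam k})"
      using finite_superlevel[OF assms(2)] v(1) assms(1) by auto
    ultimately show False using finite_subset by blast
  qed
qed

end

theory Submission
  imports Defs
begin

text \<open>
  Discarding the coordinates in \<open>g\<^bsub>n-1\<^esub>\<close> leaves a diagonal operator with entries at most
  \<open>\<epsilon>\<^sub>n\<close>, which gives all upper bounds. For the lower bound, a subspace \<open>F\<close> of dimension less
  than \<open>\<delta>\<^sub>n\<close> is annihilated by a nonzero functional \<open>f\<close> that depends only on the coordinates in
  \<open>g\<^sub>n\<close>. On these coordinates \<open>T\<close> expands by at least \<open>\<epsilon>\<^sub>n\<close>, so that the image of the unit ball
  contains points where \<open>f\<close> is nearly \<open>\<epsilon>\<^sub>n\<close> times the norm of \<open>f\<close>; their distance to \<open>F\<close> is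
  nearly \<open>\<epsilon>\<^sub>n\<close>. This duality replaces topological arguments of Borsuk type.
\<close>

section \<open>The Orlicz norm\<close>

text \<open>The norm is the Minkowski functional of the set \<open>modular M x \<le> 1\<close>, so
  norm estimates reduce to estimates of this series.\<close>

definition modular :: "(real \<Rightarrow> real) \<Rightarrow> (nat \<Rightarrow> real) \<Rightarrow> ennreal" where
  "modular M x = (\<Sum>k. ennreal (M \<bar>x k\<bar>))"

lemma orlicz_norm_modular:
  "orlicz_norm M x = Inf {ennreal \<alpha> | \<alpha>. 0 < \<alpha> \<and> modular M (\<lambda>k. x k / \<alpha>) \<le> 1}"
  unfolding orlicz_norm_def modular_def
  by (rule arg_cong[of _ _ Inf], rule Collect_cong) (auto simp: abs_divide)

lemma orlicz_norm_le:
  assumes "0 < \<alpha>" "modular M (\<lambda>k. x k / \<alpha>) \<le> 1"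
  shows "orlicz_norm M x \<le> ennreal \<alpha>"
  unfolding orlicz_norm_modular using assms by (intro Inf_lower) auto

lemma orlicz_norm_ge:
  assumes "\<And>\<alpha>. 0 < \<alpha> \<Longrightarrow> modular M (\<lambda>k. x k / \<alpha>) \<le> 1 \<Longrightarrow> c \<le> \<alpha>"
  shows "ennreal c \<le> orlicz_norm M x"
  unfolding orlicz_norm_modular using assms by (intro Inf_greatest) (auto intro: ennreal_leI)

lemma modular_mono:
  assumes "orlicz M" "\<And>k. \<bar>x k\<bar> \<le> \<bar>y k\<bar>"
  shows "modular M x \<le> modular M y"
proof -
  have "M \<bar>x k\<bar> \<le> M \<bar>y k\<bar>" for k
    using assms by (auto simp: orlicz_def intro!: mono_onD[of "{0..}" M])
  then show ?thesis unfolding modular_def by (intro suminf_le ennreal_leI) auto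
qed

text \<open>If \<open>\<alpha>\<close> is admissible for \<open>x\<close>, then
  \<open>c * \<alpha>\<close> is admissible for \<open>y\<close>. The slack \<open>e\<close> avoids
  having to show that the infimum in the norm is attained.\<close>

lemma orlicz_norm_le_mult:
  assumes M: "orlicz M" and c: "0 < c" and dom: "\<And>k. \<bar>y k\<bar> \<le> c * \<bar>x k\<bar>"
    and x: "orlicz_norm M x \<le> 1"
  shows "orlicz_norm M y \<le> ennreal c"
proof (rule ennreal_le_epsilon)
  fix e :: real assume e: "0 < e"
  \<comment> \<open>The slack \<open>e / c\<close> becomes \<open>e\<close> after scaling by
    \<open>c\<close>.\<close>
  have "(1::ennreal) < ennreal (1 + e / c)"
    using e c by (simp flip: ennreal_1 add: ennreal_less_iff)
  then have "orlicz_norm M x < ennreal (1 + e / c)"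
    using x by (rule le_less_trans[rotated])
  then obtain \<alpha> where \<alpha>: "0 < \<alpha>" "modular M (\<lambda>k. x k / \<alpha>) \<le> 1" "ennreal \<alpha> < ennreal (1 + e / c)"
    unfolding orlicz_norm_modular Inf_less_iff by auto
  have "modular M (\<lambda>k. y k / (c * \<alpha>)) \<le> modular M (\<lambda>k. x k / \<alpha>)"
    using dom c \<alpha>(1) by (intro modular_mono[OF M]) (simp add: field_simps abs_mult)
  then have "orlicz_norm M y \<le> ennreal (c * \<alpha>)"
    using \<alpha> c by (intro orlicz_norm_le) auto
  also have "\<dots> \<le> ennreal (c + e)"
    using \<alpha> c e by (intro ennreal_leI) (auto simp: ennreal_less_iff field_simps)
  finally show "orlicz_norm M y \<le> ennreal c + ennreal e"
    using c e by (simp add: ennreal_plus)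
qed

lemma modular_le_1_in_ball:
  assumes "modular M x \<le> 1"
  shows "x \<in> orlicz_ball M"
proof -
  have "orlicz_norm M x \<le> 1"
    using orlicz_norm_le[of 1 M x] assms by simp
  then show ?thesis
    by (auto simp: orlicz_ball_def orlicz_space_def intro: le_less_trans)
qed

lemma orlicz_le_linear:
  assumes "orlicz M" "0 \<le> s" "s \<le> 1"
  shows "M s \<le> s * M 1"
proof -
  have "M ((1 - s) *\<^sub>R 0 + s *\<^sub>R 1) \<le> (1 - s) * M 0 + s * M 1"
    using assms by (intro convex_onD[of "{0..}" M]) (auto simp: orlicz_def)
  then show ?thesis using assms by (simp add: orlicz_def)
qed

lemma modular_finite_support:
  assumes M: "orlicz M" and A: "finite A" and supp: "\<And>k. k \<notin> A \<Longrightarrow> x k = 0"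
  shows "\<exists>\<alpha>>0. modular M (\<lambda>k. x k / \<alpha>) \<le> 1"
proof -
  define s where "s = (\<Sum>k\<in>A. \<bar>x k\<bar>)"
  \<comment> \<open>This choice dominates \<open>s\<close>, which puts every quotient into [0,1],
    where convexity gives a linear bound, and \<open>s * M 1\<close>, which brings the sum of these
    bounds below 1. The added units keep it positive.\<close>
  define \<alpha> where "\<alpha> = (s + 1) * (M 1 + 1)"
  have M1: "0 \<le> M 1" and M0: "M 0 = 0" using M by (auto simp: orlicz_def)
  have s: "0 \<le> s" by (auto simp: s_def intro: sum_nonneg)
  have "0 \<le> s * M 1" using s M1 by simp
  then have \<alpha>: "s \<le> \<alpha>" "s * M 1 \<le> \<alpha>" "0 < \<alpha>"
    using s M1 unfolding \<alpha>_def distrib_left distrib_right by linarith+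
  have bd: "M (\<bar>x k\<bar> / \<alpha>) \<le> \<bar>x k\<bar> / \<alpha> * M 1" if "k \<in> A" for k
  proof -
    have "\<bar>x k\<bar> \<le> s" using A that by (auto simp: s_def intro: member_le_sum)
    then show ?thesis using \<alpha> by (intro orlicz_le_linear[OF M]) auto
  qed
  have "modular M (\<lambda>k. x k / \<alpha>) = (\<Sum>k\<in>A. ennreal (M (\<bar>x k\<bar> / \<alpha>)))"
    unfolding modular_def using A supp M0 \<alpha> by (subst suminf_finite[of A]) auto
  also have "\<dots> = ennreal (\<Sum>k\<in>A. M (\<bar>x k\<bar> / \<alpha>))"
    using M \<alpha> by (intro sum_ennreal) (auto simp: orlicz_def)
  also have "(\<Sum>k\<in>A. M (\<bar>x k\<bar> / \<alpha>)) \<le> (\<Sum>k\<in>A. \<bar>x k\<bar> / \<alpha> * M 1)"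
    by (intro sum_mono bd)
  also have "(\<Sum>k\<in>A. \<bar>x k\<bar> / \<alpha> * M 1) = s * M 1 / \<alpha>"
    by (simp add: s_def sum_distrib_right sum_divide_distrib)
  also have "\<dots> \<le> 1" using \<alpha> by simp
  finally have "modular M (\<lambda>k. x k / \<alpha>) \<le> 1" by (simp add: ennreal_leI)
  then show ?thesis using \<alpha>(3) by blast
qed

lemma finite_support_in_orlicz_space:
  assumes "orlicz M" "finite A" "\<And>k. k \<notin> A \<Longrightarrow> x k = 0"
  shows "x \<in> orlicz_space M"
proof -
  obtain \<alpha> where "0 < \<alpha>" "modular M (\<lambda>k. x k / \<alpha>) \<le> 1"
    using modular_finite_support[OF assms(1,2), of x] assms(3) by blast
  then have "orlicz_norm M x \<le> ennreal \<alpha>" by (rule orlicz_norm_le)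
  also have "\<dots> < \<infinity>" by simp
  finally show ?thesis by (simp add: orlicz_space_def)
qed

text \<open>Since \<open>M\<close> tends to infinity, a single large coordinate already pushes the
  modular above 1. The uniform bound makes functionals of finitely many coordinates bounded on the
  modular ball.\<close>

lemma modular_coordinate_bound:
  assumes "orlicz M"
  shows "\<exists>c. \<forall>x k. modular M x \<le> 1 \<longrightarrow> \<bar>x k\<bar> \<le> c"
proof -
  have "eventually (\<lambda>t. 1 < M t) at_top"
    using assms by (auto simp: orlicz_def filterlim_at_top_dense)
  then obtain c where c: "\<And>t. c \<le> t \<Longrightarrow> 1 < M t"
    by (auto simp: eventually_at_top_linorder)
  have "\<bar>x k\<bar> \<le> c" if "modular M x \<le> 1" for x k
  proof (rule ccontr)
    assume "\<not> \<bar>x k\<bar> \<le> c"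
    then have "1 < ennreal (M \<bar>x k\<bar>)"
      using c[of "\<bar>x k\<bar>"] by (simp flip: ennreal_1 add: ennreal_less_iff)
    also have "\<dots> \<le> modular M x"
      unfolding modular_def using sum_le_suminf[of "\<lambda>k. ennreal (M \<bar>x k\<bar>)" "{k}"] by simp
    finally show False using that by simp
  qed
  then show ?thesis by blast
qed

section \<open>Spans of unit sequences\<close>

lemma sum_fun_apply: "(\<Sum>i\<in>A. f i) x = (\<Sum>i\<in>A. f i x)"
  by (induction A rule: infinite_finite_induct) auto

lemma sum_scaleR_unit_seq:
  assumes "finite A"
  shows "(\<Sum>i\<in>A. a i *\<^sub>R unit_seq i) = (\<lambda>k. if k \<in> A then a k else 0)"
proof
  fix k
  have "(\<Sum>i\<in>A. a i *\<^sub>R unit_seq i) k = (\<Sum>i\<in>A. if k = i then a i else 0)"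
    by (auto simp: sum_fun_apply scaleR_fun_def unit_seq_def intro: sum.cong)
  also have "\<dots> = (if k \<in> A then a k else 0)"
    using assms by simp
  finally show "(\<Sum>i\<in>A. a i *\<^sub>R unit_seq i) k = (if k \<in> A then a k else 0)" .
qed

lemma inj_unit_seq: "inj unit_seq"
  by (auto simp: inj_def unit_seq_def fun_eq_iff split: if_splits)

lemma independent_unit_seq:
  assumes "finite A"
  shows "independent (unit_seq ` A)"
proof (rule independent_if_scalars_zero)
  show "finite (unit_seq ` A)" using assms by simp
  fix f x assume sum: "(\<Sum>x\<in>unit_seq ` A. f x *\<^sub>R x) = 0" and "x \<in> unit_seq ` A"
  then obtain i where i: "i \<in> A" "x = unit_seq i" by auto
  have "(\<Sum>i\<in>A. f (unit_seq i) *\<^sub>R unit_seq i) = 0"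
    using sum by (subst (asm) sum.reindex) (auto intro: inj_on_subset[OF inj_unit_seq])
  then have "f (unit_seq i) = 0"
    using i(1) assms by (auto simp: sum_scaleR_unit_seq fun_eq_iff split: if_splits)
  then show "f x = 0" using i(2) by simp
qed

lemma span_unit_seq_eq_0:
  assumes "x \<in> span (unit_seq ` A)" "k \<notin> A"
  shows "x k = 0"
  using assms(1)
proof (induction rule: span_induct_alt)
  case (step c y z)
  then show ?case using assms(2) by (auto simp: scaleR_fun_def unit_seq_def split: if_splits)
qed auto

lemma span_unit_seq_in_subspaces_of_dim:
  assumes "orlicz M" "finite A"
  shows "span (unit_seq ` A) \<in> subspaces_of_dim M (card A)"
proof -
  have "span (unit_seq ` A) \<subseteq> orlicz_space M"
    using finite_support_in_orlicz_space[OF assms] span_unit_seq_eq_0 by blast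
  moreover have "card (unit_seq ` A) = card A"
    by (intro card_image inj_on_subset[OF inj_unit_seq]) simp
  ultimately show ?thesis
    using independent_unit_seq[OF assms(2)] assms(2) by (auto simp: subspaces_of_dim_def)
qed

text \<open>The coordinate subspace over \<open>A\<close> is one competitor in the infimum over
  subspaces.\<close>

lemma kolmogorov_width_le_coord_approx:
  assumes "orlicz M" "finite A"
  shows "kolmogorov_width M (card A) T \<le> coord_approx M A T"
  unfolding kolmogorov_width_def coord_approx_def
proof (intro INF_lower2[OF span_unit_seq_in_subspaces_of_dim[OF assms]] SUP_mono')
  fix x
  show "(INF u\<in>span (unit_seq ` A). orlicz_norm M (T x - u))
      \<le> (INF a. orlicz_norm M (T x - (\<Sum>i\<in>A. a i *\<^sub>R unit_seq i)))"
    by (intro INF_greatest INF_lower) (auto intro: span_sum span_scale span_base)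
qed

text \<open>The coefficients \<open>lam i * x i\<close> cancel the coordinates in \<open>A\<close>,
  and the remainder is dominated by \<open>\<epsilon>\<close> times \<open>x\<close>.\<close>

lemma coord_approx_diag_le:
  assumes M: "orlicz M" and A: "finite A" and \<epsilon>: "0 < \<epsilon>"
    and lam: "\<And>k. k \<notin> A \<Longrightarrow> \<bar>lam k\<bar> \<le> \<epsilon>"
  shows "coord_approx M A (diag_op lam) \<le> ennreal \<epsilon>"
  unfolding coord_approx_def
proof (intro SUP_least INF_lower2[OF UNIV_I])
  fix x assume x: "x \<in> orlicz_ball M"
  let ?y = "diag_op lam x - (\<Sum>i\<in>A. (lam i * x i) *\<^sub>R unit_seq i)"
  have "\<bar>?y k\<bar> \<le> \<epsilon> * \<bar>x k\<bar>" for k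
    using lam[of k] A \<epsilon>
    by (auto simp: sum_scaleR_unit_seq diag_op_def abs_mult intro: mult_right_mono)
  then show "orlicz_norm M ?y \<le> ennreal \<epsilon>"
    using x by (intro orlicz_norm_le_mult[OF M \<epsilon>, where x = x]) (auto simp: orlicz_ball_def)
qed

section \<open>The lower bound\<close>

text \<open>Stated for an indexed family because \<open>v\<close> may take a value twice. Such a
  repetition yields a relation directly; otherwise the dimension bound applies.\<close>

lemma more_vectors_than_dimension:
  fixes v :: "'a \<Rightarrow> 'b::real_vector"
  assumes G: "finite G" and t: "finite t" "card t < card G" and v: "v ` G \<subseteq> span t"
  shows "\<exists>f. (\<exists>k\<in>G. f k \<noteq> 0) \<and> (\<Sum>k\<in>G. f k *\<^sub>R v k) = 0"
proof (cases "inj_on v G")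
  case True
  then have "dependent (v ` G)"
    using independent_span_bound[OF t(1) _ v] t(2) by (auto simp: card_image)
  then obtain u where u: "\<exists>w\<in>v ` G. u w \<noteq> 0" "(\<Sum>w\<in>v ` G. u w *\<^sub>R w) = 0"
    using dependent_finite[of "v ` G"] G by auto
  have "(\<Sum>k\<in>G. u (v k) *\<^sub>R v k) = 0"
    using u(2) True by (simp add: sum.reindex)
  then show ?thesis using u(1) by (intro exI[of _ "\<lambda>k. u (v k)"]) auto
next
  case False
  then obtain k l where kl: "k \<in> G" "l \<in> G" "k \<noteq> l" "v k = v l"
    by (auto simp: inj_on_def)
  define f where "f j = (if j = k then 1 else 0) - (if j = l then 1 else (0::real))" for j
  have "(\<Sum>j\<in>G. f j *\<^sub>R v j) =
      (\<Sum>j\<in>G. if j = k then v j else 0) - (\<Sum>j\<in>G. if j = l then v j else 0)"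
    unfolding f_def sum_subtractf[symmetric] by (intro sum.cong) (auto simp: scaleR_diff_left)
  also have "\<dots> = 0" using kl G by simp
  finally show ?thesis using kl by (intro exI[of _ f]) (auto simp: f_def)
qed

text \<open>A homogeneous linear system with \<open>card B\<close> equations in the
  \<open>card G\<close> unknowns \<open>f k\<close> has a nonzero solution.\<close>

lemma ex_annihilating_functional:
  fixes B :: "('a \<Rightarrow> real) set"
  assumes G: "finite G" and B: "finite B" "card B < card G"
  shows "\<exists>f. (\<exists>k\<in>G. f k \<noteq> 0) \<and> (\<forall>b\<in>span B. (\<Sum>k\<in>G. f k * b k) = 0)"
proof -
  \<comment> \<open>The vector \<open>v k\<close> is column \<open>k\<close> of the matrix of this
    system, with rows indexed by \<open>B\<close>; the indicators \<open>e b\<close> play the role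
    of the standard basis of the column space.\<close>
  define e :: "('a \<Rightarrow> real) \<Rightarrow> ('a \<Rightarrow> real) \<Rightarrow> real" where "e b c = of_bool (c = b)" for b c
  define v where "v k = (\<Sum>b\<in>B. b k *\<^sub>R e b)" for k
  have v_apply: "v k b = b k" if "b \<in> B" for k b
  proof -
    have "v k b = (\<Sum>c\<in>B. if b = c then c k else 0)"
      unfolding v_def sum_fun_apply by (intro sum.cong) (auto simp: scaleR_fun_def e_def)
    then show ?thesis using that B by simp
  qed
  have "card (e ` B) < card G"
    using card_image_le[OF B(1), of e] B(2) by linarith
  moreover have "v ` G \<subseteq> span (e ` B)"
    unfolding v_def by (intro image_subsetI span_sum span_scale span_base imageI)
  ultimately obtain f where f: "\<exists>k\<in>G. f k \<noteq> 0" "(\<Sum>k\<in>G. f k *\<^sub>R v k) = 0"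
    using more_vectors_than_dimension[OF G, of "e ` B" v] B(1) by auto
  have base: "(\<Sum>k\<in>G. f k * b k) = 0" if "b \<in> B" for b
    using fun_cong[OF f(2), of b] that by (simp add: sum_fun_apply scaleR_fun_def v_apply)
  have "(\<Sum>k\<in>G. f k * b k) = 0" if "b \<in> span B" for b
    using that
  proof (induction rule: span_induct_alt)
    case (step c x y)
    then show ?case
      using base[OF step(1)]
      by (simp add: scaleR_fun_def distrib_left sum.distrib mult.left_commute flip: sum_distrib_left)
  qed simp
  then show ?thesis using f(1) by blast
qed

text \<open>The factor \<open>q\<close> is there because the supremum of the functional over the
  modular ball need not be attained.\<close>

lemma le_dist_to_subspace:
  assumes M: "orlicz M" and G: "finite G" and \<epsilon>: "0 < \<epsilon>" and lam: "\<And>k. k \<in> G \<Longrightarrow> \<epsilon> \<le> lam k"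
    and B: "finite B" "card B < card G" and q: "0 < q" "q < 1"
  shows "\<exists>z\<in>orlicz_ball M. \<forall>u\<in>span B. ennreal (q * \<epsilon>) \<le> orlicz_norm M (diag_op lam z - u)"
proof -
  obtain f j where j: "j \<in> G" "f j \<noteq> 0" and f: "\<And>b. b \<in> span B \<Longrightarrow> (\<Sum>k\<in>G. f k * b k) = 0"
    using ex_annihilating_functional[OF G B] by blast
  define F where "F x = (\<Sum>k\<in>G. f k * x k)" for x
  define U where "U = {x. modular M x \<le> 1}"
  \<comment> \<open>This is the dual norm of the functional \<open>F\<close>.\<close>
  define S where "S = (SUP x\<in>U. \<bar>F x\<bar>)"
  obtain c where c: "\<And>x k. x \<in> U \<Longrightarrow> \<bar>x k\<bar> \<le> c"
    using modular_coordinate_bound[OF M] by (auto simp: U_def)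
  have "\<bar>F x\<bar> \<le> (\<Sum>k\<in>G. \<bar>f k\<bar> * c)" if "x \<in> U" for x
  proof -
    have "\<bar>F x\<bar> \<le> (\<Sum>k\<in>G. \<bar>f k * x k\<bar>)" unfolding F_def by (rule sum_abs)
    also have "\<dots> \<le> (\<Sum>k\<in>G. \<bar>f k\<bar> * c)"
      using c[OF that] by (intro sum_mono) (auto simp: abs_mult intro: mult_left_mono)
    finally show ?thesis .
  qed
  then have bdd: "bdd_above ((\<lambda>x. \<bar>F x\<bar>) ` U)" by (auto intro!: bdd_aboveI)
  \<comment> \<open>A scaled unit sequence at \<open>j\<close>, where \<open>f\<close> does not
    vanish, shows that \<open>U\<close> is nonempty and \<open>S\<close> is positive.\<close>
  obtain \<alpha> where \<alpha>: "0 < \<alpha>" "(\<lambda>k. unit_seq j k / \<alpha>) \<in> U"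
    using modular_finite_support[OF M, of "{j}" "unit_seq j"] by (auto simp: unit_seq_def U_def)
  have "F (\<lambda>k. unit_seq j k / \<alpha>) = (\<Sum>k\<in>G. if k = j then f k / \<alpha> else 0)"
    unfolding F_def by (intro sum.cong) (auto simp: unit_seq_def)
  also have "\<dots> = f j / \<alpha>" using G j by simp
  finally have "\<bar>f j / \<alpha>\<bar> \<le> S"
    unfolding S_def using cSUP_upper[OF \<alpha>(2) bdd] by simp
  moreover have "0 < \<bar>f j / \<alpha>\<bar>" using \<alpha>(1) j(2) by simp
  ultimately have S: "0 < S" by linarith
  have "q * S < S" using S q by simp
  then obtain x where x: "x \<in> U" "q * S < \<bar>F x\<bar>"
    unfolding S_def using less_cSUP_iff[OF _ bdd] \<alpha>(2) by auto
  \<comment> \<open>Up to the factor \<open>\<epsilon>\<close>, this is the preimage under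
    \<open>diag_op lam\<close> of \<open>x\<close> restricted to \<open>G\<close>. As
    \<open>lam\<close> is at least \<open>\<epsilon>\<close> on \<open>G\<close>, passing from
    \<open>x\<close> to \<open>z\<close> increases no coordinate in absolute value.\<close>
  define z where "z k = (if k \<in> G then \<epsilon> * x k / lam k else 0)" for k
  have "\<bar>z k\<bar> \<le> \<bar>x k\<bar>" for k
  proof (cases "k \<in> G")
    case True
    have "\<epsilon> * \<bar>x k\<bar> \<le> lam k * \<bar>x k\<bar>" "0 < lam k"
      using lam[OF True] \<epsilon> by (auto intro: mult_right_mono)
    then show ?thesis using True \<epsilon> by (simp add: z_def abs_mult divide_le_eq mult.commute)
  qed (simp add: z_def)
  then have "modular M z \<le> modular M x" by (rule modular_mono[OF M])
  then have z: "z \<in> orlicz_ball M"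
    using x(1) by (intro modular_le_1_in_ball) (auto simp: U_def)
  have Tz: "F (diag_op lam z) = \<epsilon> * F x"
  proof -
    have "lam k \<noteq> 0" if "k \<in> G" for k using lam[OF that] \<epsilon> by auto
    then show ?thesis
      unfolding F_def sum_distrib_left by (intro sum.cong) (auto simp: diag_op_def z_def)
  qed
  \<comment> \<open>For any admissible scale \<open>\<alpha>\<close>, the scaled difference lies in
    \<open>U\<close>, where \<open>F\<close> is bounded by \<open>S\<close>, while \<open>F\<close>
    does not see \<open>u\<close>.\<close>
  have "q * \<epsilon> \<le> \<alpha>"
    if u: "u \<in> span B" and \<alpha>: "0 < \<alpha>" "modular M (\<lambda>k. (diag_op lam z - u) k / \<alpha>) \<le> 1" for u \<alpha>
  proof -
    have "F (\<lambda>k. (diag_op lam z - u) k / \<alpha>) = (F (diag_op lam z) - F u) / \<alpha>"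
      by (simp add: F_def sum_divide_distrib right_diff_distrib sum_subtractf diff_divide_distrib)
    then have "F (\<lambda>k. (diag_op lam z - u) k / \<alpha>) = \<epsilon> * F x / \<alpha>"
      using Tz f[OF u] by (simp add: F_def)
    then have "\<epsilon> * \<bar>F x\<bar> / \<alpha> \<le> S"
      unfolding S_def using cSUP_upper[OF _ bdd, of "\<lambda>k. (diag_op lam z - u) k / \<alpha>"] \<alpha> \<epsilon>
      by (simp add: U_def abs_mult)
    then have "\<epsilon> * \<bar>F x\<bar> \<le> S * \<alpha>" using \<alpha>(1) by (simp add: divide_le_eq)
    moreover have "\<epsilon> * (q * S) \<le> \<epsilon> * \<bar>F x\<bar>" using x(2) \<epsilon> by simp
    ultimately have "S * (q * \<epsilon>) \<le> S * \<alpha>" by (simp add: algebra_simps)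
    then show ?thesis using S by simp
  qed
  then show ?thesis using z orlicz_norm_ge by blast
qed

lemma kolmogorov_width_diag_ge:
  assumes M: "orlicz M" and G: "finite G" "\<nu> < card G" and \<epsilon>: "0 < \<epsilon>"
    and lam: "\<And>k. k \<in> G \<Longrightarrow> \<epsilon> \<le> lam k"
  shows "ennreal \<epsilon> \<le> kolmogorov_width M \<nu> (diag_op lam)"
  unfolding kolmogorov_width_def
proof (rule INF_greatest)
  fix F assume "F \<in> subspaces_of_dim M \<nu>"
  then obtain B where B: "finite B" "card B < card G" "F = span B"
    using G(2) by (auto simp: subspaces_of_dim_def)
  define D where "D = (SUP x\<in>orlicz_ball M. INF u\<in>F. orlicz_norm M (diag_op lam x - u))"
  \<comment> \<open>The point \<open>z\<close> depends on \<open>q\<close>, so \<open>q\<close> can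
    tend to 1 only after passing to the supremum \<open>D\<close>.\<close>
  have *: "ennreal (q * \<epsilon>) \<le> D" if q: "0 < q" "q < 1" for q
  proof -
    obtain z where "z \<in> orlicz_ball M"
        "\<And>u. u \<in> F \<Longrightarrow> ennreal (q * \<epsilon>) \<le> orlicz_norm M (diag_op lam z - u)"
      using le_dist_to_subspace[where lam = lam, OF M G(1) \<epsilon> lam B(1,2) q] B(3) by auto
    then show ?thesis unfolding D_def by (intro SUP_upper2[of z] INF_greatest)
  qed
  have "ennreal \<epsilon> \<le> D"
  proof (cases D)
    case (real r)
    then have "q * \<epsilon> \<le> r" if "0 < q" "q < 1" for q using *[OF that] by simp
    then have "\<epsilon> \<le> r" by (rule field_le_mult_one_interval)
    then show ?thesis using real by (simp add: ennreal_leI)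
  qed simp
  then show "ennreal \<epsilon> \<le> (SUP x\<in>orlicz_ball M. INF u\<in>F. orlicz_norm M (diag_op lam x - u))"
    by (simp add: D_def)
qed

section \<open>Characteristic sequences\<close>

lemma le_char_eps:
  assumes pos: "\<And>k. 0 < lam k" and lim: "lam \<longlonglongrightarrow> 0" and n: "1 \<le> n"
    and k: "k \<notin> char_g lam (n - 1)"
  shows "lam k \<le> char_eps lam n"
\<comment> \<open>For \<open>n = 1\<close> the excluded set is empty and the bound is the maximum of
  all values; afterwards it is the greatest value below the preceding one.\<close>
proof (cases "n = 1")
  case True
  then show ?thesis using Greatest_value(3)[OF pos lim, of "\<lambda>_. True" "lam k"] by auto
next
  case False
  then obtain m where m: "n = Suc (Suc m)"
    using n that[of "n - 2"] by simp
  have "lam k < char_eps lam (Suc m)" using k m by (auto simp: char_g_def)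
  then show ?thesis
    using Greatest_value(3)[OF pos lim
        ex_smaller_value[OF pos lim char_eps_in_range[OF pos lim]], of "lam k" m] m by simp
qed

text \<open>An index at which the value \<open>char_eps lam n\<close> is attained lies only in the
  larger set. Strictness makes the order \<open>char_delta lam (n - 1)\<close> small enough for the
  lower bound.\<close>

lemma char_g_strict_subset:
  assumes pos: "\<And>k. 0 < lam k" and lim: "lam \<longlonglongrightarrow> 0" and n: "1 \<le> n"
  shows "char_g lam (n - 1) \<subset> char_g lam n"
proof -
  obtain k where k: "lam k = char_eps lam n"
    using char_eps_in_range[OF pos lim, of "n - 1"] n by auto
  have less: "char_eps lam n < char_eps lam (n - 1)" if "n - 1 \<noteq> 0"
    using that by (intro char_eps_less[OF pos lim]) auto
  have "k \<in> char_g lam n - char_g lam (n - 1)"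
    using k n less by (auto simp: char_g_def)
  moreover have "char_g lam (n - 1) \<subseteq> char_g lam n"
    using n less by (auto simp: char_g_def)
  ultimately show ?thesis by blast
qed

theorem theorem2:
  fixes M :: "real \<Rightarrow> real" and lam :: "nat \<Rightarrow> real" and n :: nat
  assumes "orlicz M"
    and "\<And>k. 0 < lam k"
    and "lam \<longlonglongrightarrow> 0"
    and "1 \<le> n"
  shows "(\<forall>\<nu>. char_delta lam (n - 1) \<le> \<nu> \<and> \<nu> < char_delta lam n \<longrightarrow>
            kolmogorov_width M \<nu> (diag_op lam) = ennreal (char_eps lam n))
       \<and> coord_approx M (char_g lam (n - 1)) (diag_op lam) = ennreal (char_eps lam n)"
proof -
  note M = assms(1) and pos = assms(2) and lim = assms(3) and n = assms(4)
  let ?\<epsilon> = "char_eps lam n" and ?G = "char_g lam n" and ?H = "char_g lam (n - 1)"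
  have fin: "finite ?G" "finite ?H" using finite_char_g[OF pos lim] by auto
  have sub: "?H \<subset> ?G" by (rule char_g_strict_subset[OF pos lim n])
  have \<epsilon>: "0 < ?\<epsilon>" using char_eps_in_range[OF pos lim, of "n - 1"] pos n by auto
  \<comment> \<open>Supersets of \<open>?H\<close> are allowed in order to reach the intermediate
    orders \<nu>.\<close>
  have upper: "coord_approx M A (diag_op lam) \<le> ennreal ?\<epsilon>" if "?H \<subseteq> A" "finite A" for A
  proof (rule coord_approx_diag_le[OF M that(2) \<epsilon>])
    fix k assume "k \<notin> A"
    then show "\<bar>lam k\<bar> \<le> ?\<epsilon>" using le_char_eps[OF pos lim n, of k] pos[of k] that(1) by auto
  qed
  have lower: "ennreal ?\<epsilon> \<le> kolmogorov_width M \<nu> (diag_op lam)" if "\<nu> < card ?G" for \<nu>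
    using n by (intro kolmogorov_width_diag_ge[OF M fin(1) that \<epsilon>]) (auto simp: char_g_def)
  have width: "kolmogorov_width M \<nu> (diag_op lam) = ennreal ?\<epsilon>"
    if \<nu>: "card ?H \<le> \<nu>" "\<nu> < card ?G" for \<nu>
  proof -
    \<comment> \<open>The upper bound for order \<nu> uses a coordinate subspace of exactly this
      dimension.\<close>
    obtain A where A: "?H \<subseteq> A" "A \<subseteq> ?G" "card A = \<nu>"
      using exists_subset_between[of ?H \<nu> ?G] \<nu> sub fin by auto
    then have "finite A" using fin finite_subset by blast
    then have "kolmogorov_width M \<nu> (diag_op lam) \<le> ennreal ?\<epsilon>"
      using kolmogorov_width_le_coord_approx[OF M, of A] upper[of A] A order_trans by blast
    then show ?thesis using lower[OF \<nu>(2)] by (rule antisym)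
  qed
  \<comment> \<open>The lower bound passes from the width of order \<open>card ?H\<close> to the
    coordinate approximation.\<close>
  have "ennreal ?\<epsilon> \<le> coord_approx M ?H (diag_op lam)"
    using lower[OF psubset_card_mono[OF fin(1) sub]]
      kolmogorov_width_le_coord_approx[OF M fin(2)] by (rule order_trans)
  then have "coord_approx M ?H (diag_op lam) = ennreal ?\<epsilon>"
    using upper[OF order_refl fin(2)] by (intro antisym)
  then show ?thesis using width by (auto simp: char_delta_def)
qed

end
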